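(* Let $k$ be a field, let $V$ be a normed vector space over $K_\infty$ of finite dimension $d$, and let $\Lambda$ be an $A$-lattice in $V$. Then there exist $\omega_1,\ldots,\omega_d\in\Lambda$ (an orthogonal successive minimum basis of $\Lambda$) such that: 1) $\omega_1,\ldots,\omega_d$ generate $\Lambda$ as an $A$-module; 2) $\omega_1,\ldots,\omega_d$ generate $V$ as a $K_\infty$-vector space; 3) $\|\omega_1\|\le\cdots\le\|\omega_d\|$; 4) $\|v\|=\max_{1\le i\le d}|\lambda_i|\,\|\omega_i\|$ for every $v=\sum_{i=1}^d\lambda_i\omega_i$ with $\lambda_1,\ldots,\lambda_d\in K_\infty$.
   Context: Notation: $A=k[T]$, $K=k(T)$, $\pi=T^{-1}$. $K_\infty=k((\pi))$ is the completion of $K$ with respect to the discrete valuation $-\deg$, equipped with the absolute value $|x|=\sigma^{\infty(x)}$, where $0<\sigma<1$ is a fixed real number and $\infty(\cdot)$ is the extension of $-\deg$ to $K_\infty$ (so $|a|=\sigma^{-\deg a}$ for $0\ne a\in A$). A normed $K_\infty$-vector space is a $K_\infty$-vector space $V$ with a function $\|\cdot\|:V\to\mathbb{R}^{\ge0}$ such that $\|v\|=0\Leftrightarrow v=0$, $\|\lambda v\|=|\lambda|\,\|v\|$, and $\|v+w\|\le\max(\|v\|,\|w\|)$ for all $v,w\in V$, $\lambda\in K_\infty$. An $A$-lattice in the $d$-dimensional space $V$ is the $A$-submodule of $V$ generated over $A$ by some $K_\infty$-basis of $V$. *)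

theory Defs
  imports Complex_Main "HOL-Computational_Algebra.Formal_Laurent_Series"
begin

text \<open>
  The field \<open>K\<^sub>\<infinity> = k((\<pi>))\<close> is the type of formal Laurent series over \<open>'k\<close>, with uniformizer
  \<open>\<pi> =\<close> \<^const>\<open>fls_X\<close>, and \<open>A = k[T]\<close> is \<open>'k poly\<close>. Since \<open>\<pi> = T\<^sup>-\<^sup>1\<close>, the inclusion of \<open>A\<close>
  in \<open>K\<^sub>\<infinity>\<close> is evaluation at \<open>T = \<pi>\<^sup>-\<^sup>1\<close>.
\<close>

definition poly_to_Kinf :: "'k::field poly \<Rightarrow> 'k fls" where
  "poly_to_Kinf p = poly (map_poly fls_const p) fls_X_inv"

text \<open>
  \<^const>\<open>fls_subdegree\<close> is the \<open>\<pi>\<close>-adic valuation of a nonzero series (its value at \<open>0\<close> is a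
  dummy).
\<close>

definition Kinf_abs :: "real \<Rightarrow> 'k::field fls \<Rightarrow> real" where
  "Kinf_abs \<sigma> x = (if x = 0 then 0 else \<sigma> powi fls_subdegree x)"

locale normed_Kinf_space = vector_space scale
  for scale :: "'k::field fls \<Rightarrow> 'v::ab_group_add \<Rightarrow> 'v" +
  fixes \<sigma> :: real and nrm :: "'v \<Rightarrow> real"
  assumes sigma_pos: "0 < \<sigma>" and sigma_less_1: "\<sigma> < 1"
    and nrm_nonneg: "nrm v \<ge> 0"
    and nrm_eq_0_iff: "nrm v = 0 \<longleftrightarrow> v = 0"
    and nrm_scale: "nrm (scale c v) = Kinf_abs \<sigma> c * nrm v"
    and nrm_add: "nrm (v + w) \<le> max (nrm v) (nrm w)"

definition A_scale :: "('k::field fls \<Rightarrow> 'v \<Rightarrow> 'v) \<Rightarrow> 'k poly \<Rightarrow> 'v \<Rightarrow> 'v::ab_group_add" where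
  "A_scale scale p v = scale (poly_to_Kinf p) v"

definition A_span :: "('k::field fls \<Rightarrow> 'v \<Rightarrow> 'v) \<Rightarrow> 'v set \<Rightarrow> 'v::ab_group_add set" where
  "A_span scale S = module.span (A_scale scale) S"

definition A_lattice :: "('k::field fls \<Rightarrow> 'v \<Rightarrow> 'v) \<Rightarrow> 'v::ab_group_add set \<Rightarrow> bool" where
  "A_lattice scale L \<longleftrightarrow>
     (\<exists>B. \<not> module.dependent scale B \<and> module.span scale B = UNIV \<and> L = A_span scale B)"


lemma poly_to_Kinf_0 [simp]: "poly_to_Kinf 0 = 0"
  by (simp add: poly_to_Kinf_def)

lemma poly_to_Kinf_pCons:
  "poly_to_Kinf (pCons a p) = fls_const a + fls_X_inv * poly_to_Kinf p"
  by (simp add: poly_to_Kinf_def map_poly_pCons)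

lemma poly_to_Kinf_1 [simp]: "poly_to_Kinf 1 = 1"
  by (simp add: poly_to_Kinf_pCons one_pCons)

lemma poly_to_Kinf_add: "poly_to_Kinf (p + q) = poly_to_Kinf p + poly_to_Kinf q"
proof -
  have "map_poly fls_const (p + q) = map_poly fls_const p + map_poly fls_const q"
    by (rule poly_eqI) (simp add: coeff_map_poly fls_plus_const)
  thus ?thesis by (simp add: poly_to_Kinf_def)
qed

lemma poly_to_Kinf_smult: "poly_to_Kinf (smult a p) = fls_const a * poly_to_Kinf p"
proof -
  have "map_poly fls_const (smult a p) = smult (fls_const a) (map_poly fls_const p)"
    by (rule poly_eqI) (simp add: coeff_map_poly)
  thus ?thesis by (simp add: poly_to_Kinf_def)
qed

lemma poly_to_Kinf_mult: "poly_to_Kinf (p * q) = poly_to_Kinf p * poly_to_Kinf q"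
  by (induction p)
     (simp_all add: poly_to_Kinf_pCons poly_to_Kinf_add poly_to_Kinf_smult algebra_simps)

lemma poly_to_Kinf_nth:
  "fls_nth (poly_to_Kinf p) n = (if n \<le> 0 then coeff p (nat (- n)) else 0)"
proof (induction p arbitrary: n)
  case 0
  then show ?case by simp
next
  case (pCons a p)
  have "nat (- n) = Suc (nat (- (n + 1)))" if "n < 0" using that by auto
  then show ?case
    using pCons.IH
    by (cases "n < 0") (auto simp: poly_to_Kinf_pCons fls_X_inv_times_conv_shift)
qed

lemma inj_poly_to_Kinf: "inj poly_to_Kinf"
proof (rule injI, rule poly_eqI)
  fix p q :: "'a poly" and n
  assume "poly_to_Kinf p = poly_to_Kinf q"
  then have "fls_nth (poly_to_Kinf p) (- int n) = fls_nth (poly_to_Kinf q) (- int n)" by simp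
  then show "coeff p n = coeff q n" by (simp add: poly_to_Kinf_nth)
qed

lemma subdegree_poly_to_Kinf:
  assumes "p \<noteq> 0"
  shows "fls_subdegree (poly_to_Kinf p) = - int (degree p)"
proof (rule fls_subdegree_eqI)
  show "fls_nth (poly_to_Kinf p) (- int (degree p)) \<noteq> 0"
    using assms by (simp add: poly_to_Kinf_nth)
  show "fls_nth (poly_to_Kinf p) k = 0" if "k < - int (degree p)" for k
  proof -
    have "degree p < nat (- k)" using that by linarith
    then show ?thesis by (simp add: poly_to_Kinf_nth coeff_eq_0)
  qed
qed

lemma Kinf_abs_poly:
  "p \<noteq> 0 \<Longrightarrow> Kinf_abs \<sigma> (poly_to_Kinf p) = \<sigma> powi (- int (degree p))"
  using inj_poly_to_Kinf[THEN injD, of p 0]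
  by (auto simp: Kinf_abs_def subdegree_poly_to_Kinf)

text \<open>This makes \<^const>\<open>A_span\<close> the generated \<open>A\<close>-submodule.\<close>

lemma module_A_scale:
  fixes scale :: "'k::field fls \<Rightarrow> 'v::ab_group_add \<Rightarrow> 'v"
  assumes "vector_space scale"
  shows "module (A_scale scale)"
proof -
  interpret vector_space scale by fact
  show ?thesis
    by unfold_locales
       (simp_all add: A_scale_def poly_to_Kinf_add poly_to_Kinf_mult
          scale_right_distrib scale_left_distrib)
qed

end

theory Submission
  imports Defs
begin

text \<open>
  Since \<open>K\<^sub>\<infinity>\<close> is complete, the coordinates of a vector are bounded by its norm, so norms on
  \<open>\<Lambda> - {0}\<close> are bounded below. Vectors whose norms lie in distinct cosets of \<open>\<sigma>\<^sup>\<int>\<close> are independent,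
  so the norm takes only finitely many values in any interval \<open>[l, r]\<close> with \<open>l > 0\<close>. Hence
  some \<open>A\<close>-basis of \<open>\<Lambda>\<close> has the smallest sum of norms, and such a basis is orthogonal: if
  \<open>\<parallel>\<Sum> c\<^sub>b b\<parallel> < max \<bar>c\<^sub>b\<bar> \<parallel>b\<parallel>\<close>, let \<open>b\<^sub>0\<close> be the longest \<open>b\<close> attaining the maximum, divide by
  its coefficient, and replace the coefficient of each \<open>b\<close> with \<open>\<parallel>b\<parallel> \<le> \<parallel>b\<^sub>0\<parallel>\<close> by its polynomial
  part and the others by \<open>0\<close>; the resulting lattice vector is shorter than \<open>b\<^sub>0\<close> and can be exchanged for it.
\<close>

section \<open>Completeness of K_\<infinity> and polynomial parts of Laurent series\<close>

text \<open>Completeness in coordinates: coefficient \<open>k\<close> is read off at the first index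
  where it is stable. All negative coefficients come from \<open>f 0\<close>, so the diagonal family
  is bounded below and is a Laurent series.\<close>

lemma fls_coefficientwise_limit:
  fixes f :: "nat \<Rightarrow> 'a::zero fls"
  assumes "\<And>n m k. n \<le> m \<Longrightarrow> k < int n \<Longrightarrow> fls_nth (f n) k = fls_nth (f m) k"
  shows "\<exists>l. \<forall>n. \<forall>k<int n. fls_nth l k = fls_nth (f n) k"
proof -
  define g where "g k = fls_nth (f (nat (k + 1))) k" for k
  have "\<exists>N. \<forall>k<N. g k = 0"
    by (rule exI[of _ "min 0 (fls_subdegree (f 0))"]) (simp add: g_def)
  then have nth: "fls_nth (Abs_fls g) k = g k" for k
    by (rule nth_Abs_fls_ex_lower_bound)
  have "fls_nth (Abs_fls g) k = fls_nth (f n) k" if "k < int n" for n k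
    unfolding nth g_def using that by (intro assms) auto
  then show ?thesis by blast
qed

lemma powi_le_powi_iff:
  fixes \<sigma> :: real
  assumes "0 < \<sigma>" "\<sigma> < 1"
  shows "\<sigma> powi m \<le> \<sigma> powi n \<longleftrightarrow> n \<le> m"
  using power_int_strict_decreasing[of m n \<sigma>] power_int_decreasing[of n m \<sigma>] assms
  by (cases "n \<le> m") auto

lemma Kinf_abs_nonneg: "0 < \<sigma> \<Longrightarrow> 0 \<le> Kinf_abs \<sigma> x"
  by (simp add: Kinf_abs_def)

lemma Kinf_abs_0 [simp]: "Kinf_abs \<sigma> 0 = 0"
  by (simp add: Kinf_abs_def)

lemma Kinf_abs_1 [simp]: "Kinf_abs \<sigma> 1 = 1"
  by (simp add: Kinf_abs_def)

lemma Kinf_abs_pos: "0 < \<sigma> \<Longrightarrow> x \<noteq> 0 \<Longrightarrow> 0 < Kinf_abs \<sigma> x"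
  by (simp add: Kinf_abs_def)

text \<open>Turns estimates of absolute values into vanishing of coefficients, where limits and
  truncations can be checked.\<close>

lemma Kinf_abs_le_powi_iff:
  assumes "0 < \<sigma>" "\<sigma> < 1"
  shows "Kinf_abs \<sigma> x \<le> \<sigma> powi n \<longleftrightarrow> (\<forall>k<n. fls_nth x k = 0)"
proof (cases "x = 0")
  case False
  then have "Kinf_abs \<sigma> x \<le> \<sigma> powi n \<longleftrightarrow> n \<le> fls_subdegree x"
    using powi_le_powi_iff[OF assms] by (simp add: Kinf_abs_def)
  also have "\<dots> \<longleftrightarrow> (\<forall>k<n. fls_nth x k = 0)"
    using False fls_subdegree_geI[of x n] by auto
  finally show ?thesis .
qed (use assms in simp)

lemma ge_1_Kinf_abs_poly:
  assumes "0 < \<sigma>" "\<sigma> < 1" "p \<noteq> 0"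
  shows "1 \<le> Kinf_abs \<sigma> (poly_to_Kinf p)"
  using powi_le_powi_iff[OF assms(1,2), of 0] assms(3) by (simp add: Kinf_abs_poly)

text \<open>The coefficients at indices up to 0 are finite in number and belong to powers of T;
  \<open>p\<close> collects them. The remainder starts at index 1, so its absolute value is at most
  \<sigma>.\<close>

lemma ex_poly_part:
  assumes "0 < \<sigma>" "\<sigma> < 1"
  shows "\<exists>p. Kinf_abs \<sigma> (q - poly_to_Kinf p) < 1"
proof -
  define p where "p = Poly (map (\<lambda>i. fls_nth q (- int i)) [0..<Suc (nat (- fls_subdegree q))])"
  have "fls_nth (q - poly_to_Kinf p) k = 0" if "k < 1" for k
    using that by (auto simp: poly_to_Kinf_nth p_def nth_default_def nth_append simp del: upt_Suc)
  then have "Kinf_abs \<sigma> (q - poly_to_Kinf p) \<le> \<sigma> powi 1"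
    using Kinf_abs_le_powi_iff[OF assms] by blast
  with assms show ?thesis by (intro exI[of _ p]) simp
qed

section \<open>Ultrametric estimates for sums\<close>

context normed_Kinf_space
begin

sublocale A: module "A_scale scale"
  by (rule module_A_scale) unfold_locales

lemma nrm_0 [simp]: "nrm 0 = 0"
  by (simp add: nrm_eq_0_iff)

lemma nrm_pos: "v \<noteq> 0 \<Longrightarrow> 0 < nrm v"
  using nrm_nonneg[of v] nrm_eq_0_iff[of v] by linarith

lemma nrm_minus [simp]: "nrm (- v) = nrm v"
proof -
  have "fls_subdegree (- 1 :: 'k fls) = 0" by simp
  then have "Kinf_abs \<sigma> (- 1 :: 'k fls) = 1" by (simp add: Kinf_abs_def)
  then show ?thesis using nrm_scale[of "- 1" v] by simp
qed

lemma nrm_diff: "nrm (v - w) \<le> max (nrm v) (nrm w)"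
  using nrm_add[of v "- w"] by simp

lemma nrm_sum_le:
  assumes "\<And>i. i \<in> S \<Longrightarrow> nrm (f i) \<le> M" "0 \<le> M"
  shows "nrm (sum f S) \<le> M"
  using assms
proof (induction S rule: infinite_finite_induct)
  case (insert x F)
  then show ?case using nrm_add[of "f x" "sum f F"] by fastforce
qed auto

lemma nrm_sum_less:
  assumes "\<And>i. i \<in> S \<Longrightarrow> nrm (f i) < M" "0 < M"
  shows "nrm (sum f S) < M"
  using assms
proof (induction S rule: infinite_finite_induct)
  case (insert x F)
  then show ?case using nrm_add[of "f x" "sum f F"] by fastforce
qed auto

section \<open>Coordinates are bounded by the norm\<close>

text \<open>Induction on the basis: by completeness the new vector \<open>w\<close> has positive
  distance \<epsilon> from \<open>span F\<close>. This bounds the coordinate at \<open>w\<close>;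
  subtracting that term leaves a vector of \<open>span F\<close>, to which the induction hypothesis
  applies.\<close>

lemma coordinates_bounded:
  assumes "finite B" "independent B"
  shows "\<exists>\<delta>>0. \<forall>c. \<forall>b\<in>B. \<delta> * Kinf_abs \<sigma> (c b) \<le> nrm (\<Sum>b\<in>B. scale (c b) b)"
  using assms
proof (induction B rule: finite_induct)
  case empty
  then show ?case by (auto intro: exI[of _ 1])
next
  case (insert w F)
  have indF: "independent F" using insert.prems by (rule independent_mono) auto
  have w: "w \<notin> span F" using insert by (auto simp: independent_insert)
  obtain \<delta> where \<delta>: "\<delta> > 0"
    and bound: "\<And>c b. b \<in> F \<Longrightarrow> \<delta> * Kinf_abs \<sigma> (c b) \<le> nrm (\<Sum>b\<in>F. scale (c b) b)"
    using insert.IH[OF indF] by blast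
  have "\<exists>\<epsilon>>0. \<forall>u\<in>span F. \<epsilon> \<le> nrm (w + u)"
  proof (rule ccontr)
    assume none: "\<not> ?thesis"
    \<comment> \<open>The factor \<delta> cancels the one in the induction hypothesis: approximants
      \<open>n\<close> and \<open>m\<close> with \<open>n \<le> m\<close> have coefficients whose
      difference is smaller than \<open>\<sigma> ^ n\<close>, so they agree below index
      \<open>n\<close>.\<close>
    have "\<exists>c. nrm (w + (\<Sum>b\<in>F. scale (c b) b)) < \<delta> * \<sigma> ^ n" for n
    proof -
      have "0 < \<delta> * \<sigma> ^ n" using \<delta> sigma_pos by simp
      then obtain u where "u \<in> span F" "nrm (w + u) < \<delta> * \<sigma> ^ n"
        using none by (meson not_le)
      then show ?thesis using span_finite[OF insert.hyps(1)] by auto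
    qed
    then obtain C where C: "\<And>n. nrm (w + (\<Sum>b\<in>F. scale (C n b) b)) < \<delta> * \<sigma> ^ n" by metis
    have "fls_nth (C n b) k = fls_nth (C m b) k" if "n \<le> m" "k < int n" "b \<in> F" for n m k b
    proof -
      have "\<sigma> ^ m \<le> \<sigma> ^ n"
        using that sigma_pos sigma_less_1 by (intro power_decreasing) auto
      then have "\<delta> * \<sigma> ^ m \<le> \<delta> * \<sigma> ^ n" using \<delta> by simp
      then have less: "max (nrm (w + (\<Sum>b\<in>F. scale (C n b) b)))
          (nrm (w + (\<Sum>b\<in>F. scale (C m b) b))) < \<delta> * \<sigma> ^ n"
        using C[of n] C[of m] by simp
      have "\<delta> * Kinf_abs \<sigma> (C n b - C m b) \<le> nrm (\<Sum>b\<in>F. scale (C n b - C m b) b)"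
        using bound[of b "\<lambda>b. C n b - C m b"] that by simp
      also have "(\<Sum>b\<in>F. scale (C n b - C m b) b) =
          (w + (\<Sum>b\<in>F. scale (C n b) b)) - (w + (\<Sum>b\<in>F. scale (C m b) b))"
        by (simp add: scale_left_diff_distrib sum_subtractf)
      also have "nrm \<dots> < \<delta> * \<sigma> ^ n" using nrm_diff less by (rule le_less_trans)
      finally have "Kinf_abs \<sigma> (C n b - C m b) \<le> \<sigma> powi int n" using \<delta> by simp
      then show ?thesis
        unfolding Kinf_abs_le_powi_iff[OF sigma_pos sigma_less_1] using that by simp
    qed
    then have "\<forall>b\<in>F. \<exists>l. \<forall>n. \<forall>k<int n. fls_nth l k = fls_nth (C n b) k"
      by (intro ballI fls_coefficientwise_limit) auto
    then obtain c where c: "\<And>b n k. b \<in> F \<Longrightarrow> k < int n \<Longrightarrow> fls_nth (c b) k = fls_nth (C n b) k"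
      by metis
    define v where "v = w + (\<Sum>b\<in>F. scale (c b) b)"
    \<comment> \<open>\<open>K\<close> dominates \<delta> and every \<open>nrm b\<close>, so
      \<open>K * \<sigma> ^ n\<close> bounds both the norm of the \<open>n\<close>-th approximant
      and its difference from the limit \<open>v\<close>.\<close>
    define K where "K = \<delta> + (\<Sum>b\<in>F. nrm b)"
    have bK: "nrm b \<le> K" if "b \<in> F" for b
      using member_le_sum[OF that, of nrm] insert.hyps(1) nrm_nonneg \<delta>
      by (simp add: K_def)
    have K\<delta>: "\<delta> \<le> K" by (simp add: K_def sum_nonneg nrm_nonneg)
    have v_le: "nrm v \<le> K * \<sigma> ^ n" for n
    proof -
      have "nrm (\<Sum>b\<in>F. scale (c b - C n b) b) \<le> K * \<sigma> ^ n"
      proof (rule nrm_sum_le)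
        fix b assume b: "b \<in> F"
        have "Kinf_abs \<sigma> (c b - C n b) \<le> \<sigma> powi int n"
          unfolding Kinf_abs_le_powi_iff[OF sigma_pos sigma_less_1] using c b by simp
        then have "Kinf_abs \<sigma> (c b - C n b) * nrm b \<le> \<sigma> ^ n * K"
          using bK[OF b] sigma_pos nrm_nonneg by (intro mult_mono) auto
        then show "nrm (scale (c b - C n b) b) \<le> K * \<sigma> ^ n"
          by (simp add: nrm_scale mult.commute)
      qed (use K\<delta> \<delta> sigma_pos in simp)
      moreover have "\<delta> * \<sigma> ^ n \<le> K * \<sigma> ^ n" using K\<delta> sigma_pos by simp
      moreover have "v = (w + (\<Sum>b\<in>F. scale (C n b) b)) + (\<Sum>b\<in>F. scale (c b - C n b) b)"
        by (simp add: v_def scale_left_diff_distrib sum_subtractf)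
      ultimately show ?thesis
        using C[of n] nrm_add[of "w + (\<Sum>b\<in>F. scale (C n b) b)" "\<Sum>b\<in>F. scale (c b - C n b) b"]
        by simp
    qed
    have "(\<lambda>n. K * \<sigma> ^ n) \<longlonglongrightarrow> K * 0"
      using sigma_pos sigma_less_1 by (intro tendsto_intros LIMSEQ_realpow_zero) auto
    then have "nrm v \<le> K * 0" by (rule LIMSEQ_le_const) (use v_le in auto)
    then have "v = 0" using nrm_nonneg[of v] nrm_eq_0_iff[of v] by simp
    then have "w = - (\<Sum>b\<in>F. scale (c b) b)" by (simp add: v_def eq_neg_iff_add_eq_0)
    then have "w \<in> span F" by (simp add: span_neg span_sum span_scale span_base)
    with w show False by simp
  qed
  then obtain \<epsilon> where \<epsilon>: "\<epsilon> > 0" "\<And>u. u \<in> span F \<Longrightarrow> \<epsilon> \<le> nrm (w + u)" by blast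
  \<comment> \<open>Chosen so that removing the \<open>w\<close>-term enlarges the norm by at most
    the factor \<kappa>: that term has norm at most \<open>N / \<epsilon> * nrm w\<close>, and the
    summand 1 covers \<open>N\<close> itself.\<close>
  define \<kappa> where "\<kappa> = 1 + nrm w / \<epsilon>"
  have \<kappa>: "\<kappa> \<ge> 1" using \<epsilon> nrm_nonneg by (simp add: \<kappa>_def)
  define \<delta>' where "\<delta>' = min \<epsilon> (\<delta> / \<kappa>)"
  have "\<delta>' * Kinf_abs \<sigma> (c b) \<le> nrm (\<Sum>b\<in>insert w F. scale (c b) b)"
    if b: "b \<in> insert w F" for c b
  proof -
    define s where "s = (\<Sum>b\<in>F. scale (c b) b)"
    define N where "N = nrm (scale (c w) w + s)"
    have N: "N = nrm (\<Sum>b\<in>insert w F. scale (c b) b)" using insert.hyps by (simp add: N_def s_def)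
    have N0: "0 \<le> N" by (simp add: N_def nrm_nonneg)
    have sF: "s \<in> span F" by (simp add: s_def span_sum span_scale span_base)
    have cw: "\<epsilon> * Kinf_abs \<sigma> (c w) \<le> N"
    proof (cases "c w = 0")
      case False
      \<comment> \<open>Dividing by \<open>c w\<close> turns the combination into \<open>w\<close>
        plus an element of \<open>span F\<close>, where the distance \<epsilon> applies.\<close>
      have "scale (c w) w + s = scale (c w) (w + scale (inverse (c w)) s)"
        using False by (simp add: scale_right_distrib)
      then have "N = Kinf_abs \<sigma> (c w) * nrm (w + scale (inverse (c w)) s)"
        by (simp add: N_def nrm_scale)
      then show ?thesis
        using mult_right_mono[OF \<epsilon>(2)[OF span_scale[OF sF]] Kinf_abs_nonneg[OF sigma_pos]]
        by (simp add: mult.commute)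
    qed (simp add: N0)
    show ?thesis
    proof (cases "b = w")
      case True
      have "\<delta>' * Kinf_abs \<sigma> (c w) \<le> \<epsilon> * Kinf_abs \<sigma> (c w)"
        by (intro mult_right_mono) (simp_all add: \<delta>'_def Kinf_abs_nonneg sigma_pos)
      then show ?thesis using cw True N by simp
    next
      case False
      have "Kinf_abs \<sigma> (c w) \<le> N / \<epsilon>" using cw \<epsilon>(1) by (simp add: field_simps)
      then have "Kinf_abs \<sigma> (c w) * nrm w \<le> N / \<epsilon> * nrm w"
        by (rule mult_right_mono) (rule nrm_nonneg)
      also have "\<dots> \<le> N * \<kappa>" using N0 by (simp add: \<kappa>_def field_simps)
      finally have "nrm (scale (c w) w) \<le> N * \<kappa>" by (simp add: nrm_scale)
      moreover have "N \<le> N * \<kappa>" using mult_left_mono[OF \<kappa> N0] by simp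
      moreover have "nrm s \<le> max N (nrm (scale (c w) w))"
        using nrm_diff[of "scale (c w) w + s" "scale (c w) w"] by (simp add: N_def)
      ultimately have "nrm s \<le> N * \<kappa>" by linarith
      then have "\<delta> * Kinf_abs \<sigma> (c b) \<le> N * \<kappa>"
        using bound[of b c] b False by (simp add: s_def)
      then have "\<delta> / \<kappa> * Kinf_abs \<sigma> (c b) \<le> N" using \<kappa> by (simp add: field_simps)
      moreover have "\<delta>' * Kinf_abs \<sigma> (c b) \<le> \<delta> / \<kappa> * Kinf_abs \<sigma> (c b)"
        by (intro mult_right_mono) (simp_all add: \<delta>'_def Kinf_abs_nonneg sigma_pos)
      ultimately show ?thesis using N by simp
    qed
  qed
  moreover have "\<delta>' > 0" using \<epsilon> \<delta> \<kappa> by (simp add: \<delta>'_def)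
  ultimately show ?case by blast
qed

section \<open>Finitely many norm values in a bounded range away from 0\<close>

text \<open>The half-open interval from \<sigma> (excluded) to 1 (included) is a fundamental domain
  for multiplication of positive reals by integer powers of \<sigma>.\<close>

lemma powi_mult_eq_imp_eq:
  assumes "\<sigma> powi a * x = \<sigma> powi b * y" "x \<in> {\<sigma><..1}" "y \<in> {\<sigma><..1}"
  shows "a = b"
proof -
  have less: "\<sigma> powi j * y < \<sigma> powi i * x" if "i < j" "x \<in> {\<sigma><..1}" "y \<in> {\<sigma><..1}" for i j x y
  proof -
    have "\<sigma> powi j * y \<le> \<sigma> powi j * 1" using that sigma_pos by (intro mult_left_mono) auto
    also have "\<dots> \<le> \<sigma> powi (i + 1)"
      using powi_le_powi_iff[OF sigma_pos sigma_less_1] that by simp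
    also have "\<dots> = \<sigma> powi i * \<sigma>" using sigma_pos by (simp add: power_int_add)
    also have "\<dots> < \<sigma> powi i * x" using that sigma_pos by simp
    finally show ?thesis .
  qed
  show ?thesis using less[of a b x y] less[of b a y x] assms by (cases a b rule: linorder_cases) auto
qed

text \<open>In a vanishing combination the terms with nonzero coefficient would have pairwise
  distinct norms, so the largest term would equal minus a sum of strictly smaller ones,
  contradicting the ultrametric inequality.\<close>

lemma independent_if_inj_on_nrm:
  assumes "finite S" "inj_on nrm S" "nrm ` S \<subseteq> {\<sigma><..1}"
  shows "independent S"
proof (rule independent_if_scalars_zero[OF assms(1)], rule ccontr)
  fix u x assume sum0: "(\<Sum>v\<in>S. scale (u v) v) = 0" and x: "x \<in> S" "u x \<noteq> 0"
  define S' where "S' = {v \<in> S. u v \<noteq> 0}"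
  define g where "g v = nrm (scale (u v) v)" for v
  have g: "g v = \<sigma> powi fls_subdegree (u v) * nrm v" if "v \<in> S'" for v
    using that by (simp add: g_def S'_def nrm_scale Kinf_abs_def)
  have inj: "v = w" if "v \<in> S'" "w \<in> S'" "g v = g w" for v w
  proof -
    have nrms: "nrm v \<in> {\<sigma><..1}" "nrm w \<in> {\<sigma><..1}" using that assms(3) by (auto simp: S'_def)
    have eq: "\<sigma> powi fls_subdegree (u v) * nrm v = \<sigma> powi fls_subdegree (u w) * nrm w"
      using that g by simp
    have "fls_subdegree (u v) = fls_subdegree (u w)" by (rule powi_mult_eq_imp_eq[OF eq nrms])
    then have "nrm v = nrm w" using eq sigma_pos by simp
    then show ?thesis using that assms(2) by (auto simp: S'_def inj_on_def)
  qed
  have S': "finite S'" "S' \<noteq> {}" using assms(1) x by (auto simp: S'_def)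
  then obtain m where m: "m \<in> S'" "\<And>v. v \<in> S' \<Longrightarrow> g v \<le> g m"
    using Max_ge[of "g ` S'"] Max_in[of "g ` S'"]
    by (metis (no_types) finite_imageI image_iff image_is_empty)
  have gm: "0 < g m" using g[OF m(1)] m(1) assms(3) sigma_pos
    by (fastforce simp: S'_def intro!: mult_pos_pos)
  have "(\<Sum>v\<in>S'. scale (u v) v) = (\<Sum>v\<in>S. scale (u v) v)"
    using assms(1) by (intro sum.mono_neutral_left) (auto simp: S'_def)
  then have "scale (u m) m + (\<Sum>v\<in>S' - {m}. scale (u v) v) = 0"
    using sum0 sum.remove[OF S'(1) m(1), of "\<lambda>v. scale (u v) v"] by simp
  then have "scale (u m) m = - (\<Sum>v\<in>S' - {m}. scale (u v) v)"
    by (simp add: eq_neg_iff_add_eq_0)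
  then have "g m = nrm (\<Sum>v\<in>S' - {m}. scale (u v) v)" by (simp add: g_def)
  also have "\<dots> < g m"
  proof (rule nrm_sum_less)
    fix v assume "v \<in> S' - {m}"
    then show "nrm (scale (u v) v) < g m"
      using m inj[of v m] by (auto simp: g_def order.strict_iff_order)
  qed fact
  finally show False by simp
qed

lemma ex_nrm_scale_X_intpow:
  assumes "v \<noteq> 0"
  shows "\<exists>n w. nrm w \<in> {\<sigma><..1} \<and> nrm v = \<sigma> powi n * nrm w"
proof -
  define t where "t = log \<sigma> (nrm v)"
  \<comment> \<open>The fractional part \<open>t - n\<close> is in [0, 1), and \<sigma> < 1 reverses
    the order, so \<sigma> to this power is in the half-open interval.\<close>
  define n where "n = \<lfloor>t\<rfloor>"
  define w where "w = scale (fls_X_intpow (- n)) v"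
  have v: "nrm v = \<sigma> powr t" using assms nrm_pos sigma_pos sigma_less_1 by (simp add: t_def)
  have powi: "\<sigma> powi i = \<sigma> powr i" for i
    using sigma_pos by (simp add: powr_real_of_int')
  have "(fls_X_intpow (- n) :: 'k fls) \<noteq> 0"
    by (rule fls_X_intpow_nonzero)
  then have "Kinf_abs \<sigma> (fls_X_intpow (- n) :: 'k fls) = \<sigma> powi (- n)"
    by (simp add: Kinf_abs_def)
  then have w: "nrm w = \<sigma> powr (t - n)"
    by (simp add: w_def nrm_scale v powi flip: powr_add)
  have "nrm w \<le> \<sigma> powr 0" unfolding w
    using sigma_pos sigma_less_1 by (intro powr_mono') (auto simp: n_def)
  moreover have "\<sigma> powr 1 < \<sigma> powr (t - n)"
    using sigma_pos sigma_less_1 by (intro powr_less_mono') (auto simp: n_def, linarith)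
  moreover have "nrm v = \<sigma> powi n * nrm w"
    by (simp add: w v powi flip: powr_add)
  ultimately show ?thesis using sigma_pos w by (intro exI[of _ n] exI[of _ w]) auto
qed

text \<open>One vector for each value in the fundamental interval gives an independent set, so there
  are at most \<open>card B\<close> such values. Every other nonzero norm is one of them times a
  power of \<sigma>, and \<open>l\<close> and \<open>r\<close> leave finitely many
  exponents.\<close>

lemma finite_nrm_values:
  assumes B: "finite B" "span B = UNIV" and l: "0 < l"
  shows "finite (range nrm \<inter> {l..r})"
proof -
  define X where "X = range nrm \<inter> {\<sigma><..1}"
  have "finite X"
  proof (rule ccontr)
    assume "infinite X"
    then obtain Y where Y: "Y \<subseteq> X" "finite Y" "card Y = Suc (card B)"
      using infinite_arbitrarily_large by blast
    have "Y \<subseteq> nrm ` UNIV" using Y(1) by (auto simp: X_def)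
    then obtain S where S: "inj_on nrm S" "Y = nrm ` S"
      using subset_image_inj[of Y nrm UNIV] by auto
    have "finite S" using S Y(2) finite_imageD by blast
    moreover have "nrm ` S \<subseteq> {\<sigma><..1}" using S Y(1) by (auto simp: X_def)
    ultimately have "independent S" using S(1) by (intro independent_if_inj_on_nrm)
    then have "card S \<le> card B" using independent_span_bound[OF B(1)] B(2) by blast
    with S Y(3) show False by (simp add: card_image)
  qed
  obtain N where N: "\<sigma> ^ N < l" using real_arch_pow_inv[OF l sigma_less_1] by blast
  \<comment> \<open>The maximum with 1 keeps the inverse positive for every
    \<open>r\<close>.\<close>
  have "0 < inverse (max r 1)" by (simp add: less_max_iff_disj)
  then obtain M where M: "\<sigma> ^ M < inverse (max r 1)"
    using real_arch_pow_inv[OF _ sigma_less_1] by blast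
  \<comment> \<open>The lower end has an extra -1 because \<open>nrm w\<close> is only known to
    exceed \<sigma>, which costs one factor \<sigma>.\<close>
  have "range nrm \<inter> {l..r} \<subseteq> (\<lambda>(n, x). \<sigma> powi n * x) ` ({- int M - 1..int N} \<times> X)"
  proof
    fix y assume y: "y \<in> range nrm \<inter> {l..r}"
    then obtain v where v: "y = nrm v" by auto
    then have "v \<noteq> 0" using y l by auto
    then obtain n w where nw: "nrm w \<in> {\<sigma><..1}" "y = \<sigma> powi n * nrm w"
      using ex_nrm_scale_X_intpow v by blast
    have "l \<le> \<sigma> powi n * 1"
    proof -
      have "\<sigma> powi n * nrm w \<le> \<sigma> powi n * 1" using nw sigma_pos by (intro mult_left_mono) auto
      then show ?thesis using y nw(2) by simp
    qed
    then have "\<not> \<sigma> powi n \<le> \<sigma> powi int N" using N by simp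
    then have "n \<le> int N" using powi_le_powi_iff[OF sigma_pos sigma_less_1, of n "int N"] by simp
    moreover have "- int M - 1 \<le> n"
    proof -
      have "\<sigma> powi (n + 1) = \<sigma> powi n * \<sigma>" using sigma_pos by (simp add: power_int_add)
      also have "\<dots> \<le> \<sigma> powi n * nrm w" using nw sigma_pos by (intro mult_left_mono) auto
      also have "\<dots> \<le> max r 1" using y nw(2) by (simp add: le_max_iff_disj)
      also have "\<dots> \<le> inverse (\<sigma> ^ M)"
        using less_imp_inverse_less[OF M] sigma_pos by simp
      also have "\<dots> = \<sigma> powi (- int M)" by (simp add: power_int_minus)
      finally show ?thesis using powi_le_powi_iff[OF sigma_pos sigma_less_1] by simp
    qed
    ultimately show "y \<in> (\<lambda>(n, x). \<sigma> powi n * x) ` ({- int M - 1..int N} \<times> X)"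
      using nw by (auto simp: X_def intro!: image_eqI[of _ _ "(n, nrm w)"])
  qed
  then show ?thesis using \<open>finite X\<close> finite_subset by blast
qed

section \<open>Lattice bases with the smallest sum of norms\<close>

text \<open>Independence is over K_\<infinity>; since A embeds there, \<open>B\<close> is also a
  free A-basis of \<open>L\<close>.\<close>

definition lattice_basis :: "'v set \<Rightarrow> 'v set \<Rightarrow> bool" where
  "lattice_basis L B \<longleftrightarrow> finite B \<and> independent B \<and> span B = UNIV \<and> A_span scale B = L"

lemma A_span_subset_span: "A_span scale S \<subseteq> span S"
proof -
  have "A.subspace (span S)"
    by (rule A.subspaceI) (simp_all add: A_scale_def span_zero span_add span_scale)
  then show ?thesis unfolding A_span_def by (intro A.span_minimal span_superset)
qed

text \<open>A nonzero lattice vector has a nonzero polynomial coordinate, whose absolute value is at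
  least 1, and the norm bounds the coordinates.\<close>

lemma lattice_nrm_lower_bound:
  assumes "lattice_basis L B"
  shows "\<exists>\<delta>>0. \<forall>v\<in>L. v \<noteq> 0 \<longrightarrow> \<delta> \<le> nrm v"
proof -
  have B: "finite B" "independent B" and L: "L = A_span scale B"
    using assms by (auto simp: lattice_basis_def)
  obtain \<delta> where \<delta>: "\<delta> > 0"
    and bound: "\<And>c b. b \<in> B \<Longrightarrow> \<delta> * Kinf_abs \<sigma> (c b) \<le> nrm (\<Sum>b\<in>B. scale (c b) b)"
    using coordinates_bounded[OF B] by blast
  have "\<delta> \<le> nrm v" if v: "v \<in> L" "v \<noteq> 0" for v
  proof -
    obtain p where p: "v = (\<Sum>b\<in>B. A_scale scale (p b) b)"
      using v(1) A.span_finite[OF B(1)] by (auto simp: L A_span_def)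
    have "\<exists>b\<in>B. p b \<noteq> 0"
    proof (rule ccontr)
      assume "\<not> ?thesis"
      then have "v = 0" unfolding p by (intro sum.neutral) auto
      with v(2) show False by simp
    qed
    then obtain b where b: "b \<in> B" "p b \<noteq> 0" by blast
    have "\<delta> * 1 \<le> \<delta> * Kinf_abs \<sigma> (poly_to_Kinf (p b))"
      using \<delta> ge_1_Kinf_abs_poly[OF sigma_pos sigma_less_1 b(2)] by simp
    also have "\<dots> \<le> nrm v"
      using bound[OF b(1), of "\<lambda>b. poly_to_Kinf (p b)"] by (simp add: p A_scale_def)
    finally show ?thesis by simp
  qed
  with \<delta> show ?thesis by blast
qed

lemma lattice_basis_card:
  assumes "lattice_basis L B" "lattice_basis L' B'"
  shows "card B = card B'"
  using assms independent_span_bound[of B B'] independent_span_bound[of B' B]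
  by (auto simp: lattice_basis_def intro: antisym)

text \<open>There may be infinitely many bases no worse than \<open>B0\<close>, but each of their
  vectors has norm in the finite set \<open>W\<close>, and all bases have \<open>card B0\<close>
  elements. Hence only finitely many sums occur.\<close>

lemma ex_minimal_lattice_basis:
  assumes "lattice_basis L B0"
  shows "\<exists>B. lattice_basis L B \<and> (\<forall>B'. lattice_basis L B' \<longrightarrow> (\<Sum>b\<in>B. nrm b) \<le> (\<Sum>b\<in>B'. nrm b))"
proof -
  obtain \<delta> where \<delta>: "\<delta> > 0" "\<And>v. v \<in> L \<Longrightarrow> v \<noteq> 0 \<Longrightarrow> \<delta> \<le> nrm v"
    using lattice_nrm_lower_bound[OF assms] by blast
  define s where "s B = (\<Sum>b\<in>B. nrm b)" for B
  define W where "W = range nrm \<inter> {\<delta>..s B0}"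
  define Q where "Q = {B. lattice_basis L B \<and> s B \<le> s B0}"
  have "finite W" unfolding W_def
    using finite_nrm_values[of B0] assms \<delta>(1) by (simp add: lattice_basis_def)
  then have "finite (sum_list ` {xs. set xs \<subseteq> W \<and> length xs = card B0})"
    by (intro finite_imageI finite_lists_length_eq)
  \<comment> \<open>Lists keep multiplicities: different basis vectors may have the same
    norm.\<close>
  moreover have "s ` Q \<subseteq> sum_list ` {xs. set xs \<subseteq> W \<and> length xs = card B0}"
  proof
    fix y assume "y \<in> s ` Q"
    then obtain B where B: "lattice_basis L B" "s B \<le> s B0" "y = s B" by (auto simp: Q_def)
    then obtain xs where xs: "set xs = B" "distinct xs"
      using finite_distinct_list by (auto simp: lattice_basis_def)
    have "nrm b \<in> W" if b: "b \<in> B" for b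
    proof -
      have "b \<in> L" using B(1) b A.span_superset by (auto simp: lattice_basis_def A_span_def)
      moreover have "b \<noteq> 0" using B(1) b dependent_zero by (auto simp: lattice_basis_def)
      moreover have "nrm b \<le> s B" unfolding s_def
        using B(1) b nrm_nonneg by (intro member_le_sum) (auto simp: lattice_basis_def)
      ultimately show ?thesis using \<delta>(2) B(2) by (auto simp: W_def)
    qed
    moreover have "length xs = card B0"
      using distinct_card[OF xs(2)] xs(1) lattice_basis_card[OF B(1) assms] by simp
    moreover have "y = sum_list (map nrm xs)"
      using B(3) xs by (simp add: s_def sum_list_distinct_conv_sum_set)
    ultimately show "y \<in> sum_list ` {xs. set xs \<subseteq> W \<and> length xs = card B0}"
      using xs(1) by (intro image_eqI[of _ _ "map nrm xs"]) auto
  qed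
  ultimately have fin: "finite (s ` Q)" by (rule finite_subset[rotated])
  have "B0 \<in> Q" using assms by (simp add: Q_def)
  then have "Min (s ` Q) \<in> s ` Q" using fin by (intro Min_in) auto
  then obtain B where B: "B \<in> Q" "s B = Min (s ` Q)" by auto
  have "s B \<le> s B'" if "lattice_basis L B'" for B'
    using that B fin by (cases "s B' \<le> s B0") (auto simp: Q_def)
  then show ?thesis using B(1) by (auto simp: Q_def s_def)
qed

text \<open>The coefficient 1 at \<open>b0\<close> allows \<open>b0\<close> to be recovered from
  \<open>v\<close> with polynomial coefficients, so the A-span is unchanged and with it the span
  over K_\<infinity>.\<close>

lemma lattice_basis_exchange:
  assumes B: "lattice_basis L B" and b0: "b0 \<in> B" and p: "p b0 = 1"
    and v: "v = (\<Sum>b\<in>B. A_scale scale (p b) b)"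
  shows "lattice_basis L (insert v (B - {b0}))"
proof -
  let ?B = "insert v (B - {b0})"
  have fin: "finite B" and ind: "independent B" and sp: "span B = UNIV"
    and L: "A.span B = L" using B by (auto simp: lattice_basis_def A_span_def)
  have "v = b0 + (\<Sum>b\<in>B - {b0}. A_scale scale (p b) b)"
    using sum.remove[OF fin b0, of "\<lambda>b. A_scale scale (p b) b"] p v by simp
  then have "b0 = v - (\<Sum>b\<in>B - {b0}. A_scale scale (p b) b)" by simp
  moreover have "v - (\<Sum>b\<in>B - {b0}. A_scale scale (p b) b) \<in> A.span ?B"
    by (intro A.span_diff A.span_sum A.span_scale) (auto intro: A.span_base)
  ultimately have b0_in: "b0 \<in> A.span ?B" by metis
  have sub: "B \<subseteq> A.span ?B" using b0_in A.span_superset[of ?B] by blast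
  have "v \<in> A.span B" unfolding v by (intro A.span_sum A.span_scale A.span_base)
  then have "?B \<subseteq> A.span B" using A.span_superset[of B] by blast
  with sub have "A.span ?B = A.span B" by (metis A.span_eq)
  then have AL: "A_span scale ?B = L" using L by (simp add: A_span_def)
  have "B \<subseteq> span ?B" using sub A_span_subset_span[of ?B] by (auto simp: A_span_def)
  then have spB: "span ?B = UNIV" using sp span_minimal[OF _ subspace_span] by blast
  interpret fd: finite_dimensional_vector_space scale B
    by unfold_locales (use fin ind sp in auto)
  \<comment> \<open>A spanning set with at most as many elements as the dimension is independent;
    this also settles the case that \<open>v\<close> is among the other basis vectors.\<close>
  have "card ?B \<le> card B"
    using fin b0 card_insert_le_m1[of "card B" "B - {b0}" v] card_gt_0_iff[of B] by auto
  then have "independent ?B"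
    using fin spB fd.dim_UNIV by (intro fd.card_le_dim_spanning[of _ UNIV]) (auto simp: fd.dimension_def)
  then show ?thesis using fin spB AL by (simp add: lattice_basis_def)
qed

section \<open>Minimality implies orthogonality\<close>

lemma minimal_lattice_basis_orthogonal:
  assumes B: "lattice_basis L B"
    and minimal: "\<And>B'. lattice_basis L B' \<Longrightarrow> (\<Sum>b\<in>B. nrm b) \<le> (\<Sum>b\<in>B'. nrm b)"
  shows "nrm (\<Sum>b\<in>B. scale (c b) b) = Max (insert 0 ((\<lambda>b. Kinf_abs \<sigma> (c b) * nrm b) ` B))"
    (is "nrm ?v = ?M")
proof (rule ccontr)
  assume neq: "nrm ?v \<noteq> ?M"
  have fin: "finite B" and ind: "independent B" using B by (auto simp: lattice_basis_def)
  have le_M: "Kinf_abs \<sigma> (c b) * nrm b \<le> ?M" if "b \<in> B" for b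
    using fin that by (intro Max_ge) auto
  have "0 \<le> ?M" using fin by (intro Max_ge) auto
  then have "nrm ?v \<le> ?M" by (intro nrm_sum_le) (auto simp: nrm_scale le_M)
  with neq have less: "nrm ?v < ?M" by simp
  then have M_pos: "0 < ?M" using nrm_nonneg[of ?v] by linarith
  define I where "I = {b \<in> B. Kinf_abs \<sigma> (c b) * nrm b = ?M}"
  have "?M \<in> insert 0 ((\<lambda>b. Kinf_abs \<sigma> (c b) * nrm b) ` B)" using fin by (intro Max_in) auto
  then have "I \<noteq> {}" using M_pos by (force simp: I_def)
  moreover have "finite I" using fin by (simp add: I_def)
  ultimately have "Max (nrm ` I) \<in> nrm ` I" by simp
  \<comment> \<open>Taking the longest one ensures that any \<open>b\<close> longer than
    \<open>b0\<close> is outside \<open>I\<close>, so that its term is strictly below the maximum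
    and may be dropped.\<close>
  then obtain b0 where b0: "b0 \<in> I" and b0_max: "\<And>b. b \<in> I \<Longrightarrow> nrm b \<le> nrm b0"
    using \<open>finite I\<close> by (metis (no_types) Max_ge finite_imageI imageE imageI)
  have b0B: "b0 \<in> B" and b0M: "Kinf_abs \<sigma> (c b0) * nrm b0 = ?M" using b0 by (auto simp: I_def)
  have cb0: "c b0 \<noteq> 0" and nb0: "0 < nrm b0"
    using b0M M_pos by (metis Kinf_abs_0 less_irrefl mult_zero_left,
      metis less_irrefl mult_zero_right nrm_0 nrm_pos)
  \<comment> \<open>Division by \<open>c b0\<close> multiplies all norms by \<mu>, which turns the
    maximum into \<open>nrm b0\<close> and the coefficient of \<open>b0\<close> into 1.\<close>
  define \<mu> where "\<mu> = Kinf_abs \<sigma> (inverse (c b0))"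
  define q where "q b = inverse (c b0) * c b" for b
  have \<mu>: "0 < \<mu>" unfolding \<mu>_def by (rule Kinf_abs_pos) (use sigma_pos cb0 in auto)
  have q_nrm: "Kinf_abs \<sigma> (q b) * nrm b = \<mu> * (Kinf_abs \<sigma> (c b) * nrm b)" for b
    using nrm_scale[of "q b" b] nrm_scale[of "inverse (c b0)" "scale (c b) b"]
    by (simp add: q_def \<mu>_def nrm_scale)
  have q0: "q b0 = 1" using cb0 by (simp add: q_def)
  then have \<mu>M: "\<mu> * ?M = nrm b0" using q_nrm[of b0] b0M by simp
  \<comment> \<open>Each coefficient is rounded to a polynomial so that the error term is shorter
    than \<open>b0\<close>; at \<open>b0\<close> it stays 1, as the exchange requires.\<close>
  have "\<exists>p. Kinf_abs \<sigma> (q b - poly_to_Kinf p) * nrm b < nrm b0 \<and> (b = b0 \<longrightarrow> p = 1)"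
    if b: "b \<in> B" for b
  proof (cases "b = b0")
    case True
    then show ?thesis using q0 nb0 by (intro exI[of _ 1]) simp
  next
    case ne: False
    show ?thesis
    proof (cases "nrm b \<le> nrm b0")
      case True
      have "b \<noteq> 0" using ind b dependent_zero by auto
      then have "0 < nrm b" by (rule nrm_pos)
      moreover obtain p where "Kinf_abs \<sigma> (q b - poly_to_Kinf p) < 1"
        using ex_poly_part[OF sigma_pos sigma_less_1] by blast
      ultimately have "Kinf_abs \<sigma> (q b - poly_to_Kinf p) * nrm b < 1 * nrm b"
        by (intro mult_strict_right_mono)
      with True ne show ?thesis by (intro exI[of _ p]) simp
    next
      case False
      then have "b \<notin> I" using b0_max by blast
      then have "Kinf_abs \<sigma> (c b) * nrm b < ?M" using b le_M[OF b] by (auto simp: I_def)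
      then have "\<mu> * (Kinf_abs \<sigma> (c b) * nrm b) < \<mu> * ?M" using \<mu> by (rule mult_strict_left_mono)
      then show ?thesis 
        using ne unfolding \<mu>M q_nrm[symmetric] by (intro exI[of _ 0]) simp
    qed
  qed
  then obtain p where p: "\<And>b. b \<in> B \<Longrightarrow> Kinf_abs \<sigma> (q b - poly_to_Kinf (p b)) * nrm b < nrm b0"
    and p0: "p b0 = 1" using b0B by metis
  define v where "v = (\<Sum>b\<in>B. A_scale scale (p b) b)"
  \<comment> \<open>The lattice vector is the divided combination minus the rounding errors, and
    both are shorter than \<open>b0\<close>.\<close>
  have "v = scale (inverse (c b0)) ?v - (\<Sum>b\<in>B. scale (q b - poly_to_Kinf (p b)) b)"
    by (simp add: v_def A_scale_def scale_left_diff_distrib sum_subtractf scale_sum_right q_def)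
  moreover have "nrm (scale (inverse (c b0)) ?v) < nrm b0"
    using mult_strict_left_mono[OF less \<mu>] unfolding \<mu>M by (simp add: nrm_scale \<mu>_def)
  moreover have "nrm (\<Sum>b\<in>B. scale (q b - poly_to_Kinf (p b)) b) < nrm b0"
    using nb0 p by (intro nrm_sum_less) (auto simp: nrm_scale)
  ultimately have v_less: "nrm v < nrm b0"
    using nrm_diff[of "scale (inverse (c b0)) ?v" "\<Sum>b\<in>B. scale (q b - poly_to_Kinf (p b)) b"]
    by simp
  have "(\<Sum>b\<in>B. nrm b) \<le> (\<Sum>b\<in>insert v (B - {b0}). nrm b)"
    by (intro minimal lattice_basis_exchange[where p = p] B b0B p0 v_def)
  \<comment> \<open>Only an inequality, since \<open>v\<close> may already be in
    \<open>B - {b0}\<close>.\<close>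
  also have "\<dots> \<le> nrm v + (\<Sum>b\<in>B - {b0}. nrm b)"
    using fin nrm_nonneg[of v] by (simp add: sum.insert_if)
  also have "\<dots> < nrm b0 + (\<Sum>b\<in>B - {b0}. nrm b)" using v_less by simp
  also have "\<dots> = (\<Sum>b\<in>B. nrm b)" using sum.remove[OF fin b0B, of nrm] by simp
  finally show False by simp
qed

end

(* The 0 inserted in the maximum changes nothing for d >= 1 (all terms are nonnegative);
   it fixes the value of the empty maximum when d = 0. *)
theorem proposition2p11:
  fixes scale :: "'k::field fls \<Rightarrow> 'v::ab_group_add \<Rightarrow> 'v"
    and nrm :: "'v \<Rightarrow> real" and \<sigma> :: real
    and Bas :: "'v set" and d :: nat and \<Lambda> :: "'v set"
  assumes "normed_Kinf_space scale \<sigma> nrm"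
    and "finite_dimensional_vector_space scale Bas"
    and "vector_space.dim scale (UNIV :: 'v set) = d"
    and "A_lattice scale \<Lambda>"
  shows "\<exists>\<omega> :: nat \<Rightarrow> 'v.
           (\<forall>i\<in>{1..d}. \<omega> i \<in> \<Lambda>) \<and>
           A_span scale (\<omega> ` {1..d}) = \<Lambda> \<and>
           module.span scale (\<omega> ` {1..d}) = UNIV \<and>
           (\<forall>i\<in>{1..d}. \<forall>j\<in>{1..d}. i \<le> j \<longrightarrow> nrm (\<omega> i) \<le> nrm (\<omega> j)) \<and>
           (\<forall>c :: nat \<Rightarrow> 'k fls. \<forall>v. v = (\<Sum>i=1..d. scale (c i) (\<omega> i)) \<longrightarrow>
              nrm v = Max (insert 0 ((\<lambda>i. Kinf_abs \<sigma> (c i) * nrm (\<omega> i)) ` {1..d})))"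
proof -
  interpret normed_Kinf_space scale \<sigma> nrm by fact
  interpret fd: finite_dimensional_vector_space scale Bas by fact
  obtain B0 where "lattice_basis \<Lambda> B0"
    using assms(4) fd.finiteI_independent by (auto simp: A_lattice_def lattice_basis_def)
  then obtain B where B: "lattice_basis \<Lambda> B"
    and minimal: "\<And>B'. lattice_basis \<Lambda> B' \<Longrightarrow> (\<Sum>b\<in>B. nrm b) \<le> (\<Sum>b\<in>B'. nrm b)"
    using ex_minimal_lattice_basis by blast
  have fin: "finite B" and sp: "span B = UNIV" and AB: "A_span scale B = \<Lambda>"
    using B by (auto simp: lattice_basis_def)
  have cardB: "card B = d"
    using B assms(3) basis_card_eq_dim[of B UNIV] by (simp add: lattice_basis_def)
  \<comment> \<open>Orthogonality does not depend on the order of the basis, so the minimal basis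
    may be sorted by norm.\<close>
  define xs where "xs = sort_key nrm (SOME xs. set xs = B \<and> distinct xs)"
  have "set (SOME xs. set xs = B \<and> distinct xs) = B \<and> distinct (SOME xs. set xs = B \<and> distinct xs)"
    using finite_distinct_list[OF fin] by (rule someI_ex)
  then have xs: "set xs = B" "distinct xs" "sorted (map nrm xs)"
    by (simp_all add: xs_def)
  have len: "length xs = d" using distinct_card[OF xs(2)] xs(1) cardB by simp
  define \<omega> where "\<omega> i = xs ! (i - 1)" for i
  have "bij_betw (\<lambda>i. i - 1) {1..d} {..<d}"
    by (rule bij_betwI[where g = Suc]) auto
  from bij_betw_trans[OF this bij_betw_nth[OF xs(2) _ xs(1)[symmetric], of "{..<d}"]]
  have bij: "bij_betw \<omega> {1..d} B" by (simp add: \<omega>_def[abs_def] comp_def len)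
  then have img: "\<omega> ` {1..d} = B" by (simp add: bij_betw_def)
  have "nrm (\<omega> i) \<le> nrm (\<omega> j)" if "i \<in> {1..d}" "j \<in> {1..d}" "i \<le> j" for i j
    using sorted_nth_mono[OF xs(3), of "i - 1" "j - 1"] that len by (auto simp: \<omega>_def)
  moreover have "nrm (\<Sum>i=1..d. scale (c i) (\<omega> i)) =
      Max (insert 0 ((\<lambda>i. Kinf_abs \<sigma> (c i) * nrm (\<omega> i)) ` {1..d}))" for c
  proof -
    \<comment> \<open>Transports coefficients from indices to vectors, so that the result for the
      set \<open>B\<close> applies.\<close>
    define c' where "c' b = c (the_inv_into {1..d} \<omega> b)" for b
    have c': "c' (\<omega> i) = c i" if "i \<in> {1..d}" for i
      using that bij by (simp add: c'_def bij_betw_def the_inv_into_f_f)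
    have "(\<Sum>i=1..d. scale (c i) (\<omega> i)) = (\<Sum>i=1..d. scale (c' (\<omega> i)) (\<omega> i))"
      by (intro sum.cong) (simp_all add: c')
    also have "\<dots> = (\<Sum>b\<in>B. scale (c' b) b)"
      by (rule sum.reindex_bij_betw[OF bij])
    also have "nrm \<dots> = Max (insert 0 ((\<lambda>b. Kinf_abs \<sigma> (c' b) * nrm b) ` B))"
      by (rule minimal_lattice_basis_orthogonal[OF B minimal])
    also have "(\<lambda>b. Kinf_abs \<sigma> (c' b) * nrm b) ` B = (\<lambda>i. Kinf_abs \<sigma> (c i) * nrm (\<omega> i)) ` {1..d}"
      unfolding img[symmetric] image_image by (intro image_cong) (simp_all add: c')
    finally show ?thesis .
  qed
  moreover have "\<omega> i \<in> \<Lambda>" if "i \<in> {1..d}" for i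
    using that img A.span_superset[of B] AB by (auto simp: A_span_def)
  ultimately show ?thesis using AB sp unfolding img[symmetric] by blast
qed

end
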